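(* Let $1\le p\le\infty$ and let $(u_\varepsilon)_{\varepsilon\in(0,1]}$ be a family of random fields on $\mathbb R^d$ such that (i) for almost all $\omega\in\Omega$ and all $0<\varepsilon\le1$, the map $x\mapsto u_\varepsilon(x,\omega)$ belongs to $\mathcal C^\infty(\mathbb R^d)$; (ii) for all $x\in\mathbb R^d$, $\alpha\in\mathbb N_0^d$ and $0<\varepsilon\le 1$, the map $\omega\mapsto\partial^\alpha u_\varepsilon(x,\omega)$ belongs to $L^p(\Omega)$ and, for all compact $K\subset\mathbb R^d$, $\sup_{x\in K}\|\partial^\alpha u_\varepsilon(x)\|_{L^p(\Omega)}$ is finite. Then the condition (M) for all compact $K\subset\mathbb R^d$ and all $\alpha\in\mathbb N_0^d$, the family $\big(\sup_{x\in K}\|\partial^\alpha u_\varepsilon(x)\|_{L^p(\Omega)}\big)_{\varepsilon\in(0,1]}$ is moderate is equivalent to the condition ($\widetilde{\mathrm M}$) for all compact $K\subset\mathbb R^d$ and all $\alpha\in\mathbb N_0^d$, the family $\big(\big\|\sup_{x\in K}|\partial^\alpha u_\varepsilon(x)|\big\|_{L^p(\Omega)}\big)_{\varepsilon\in(0,1]}$ is moderate. Likewise, the condition obtained from (M) by replacing "moderate" by "negligible" is equivalent to the condition obtained from ($\widetilde{\mathrm M}$) by replacing "moderate" by "negligible".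
   Context: $(\Omega,\Sigma,P)$ is a complete probability space. A random field on $\mathbb R^d$ is a map $\mathbb R^d\times\Omega\to\mathbb R$, $(x,\omega)\mapsto A(x,\omega)$, such that $\omega\mapsto A(x,\omega)$ is measurable for every $x$. $\|u\|_{L^p(\Omega)}=(\int_\Omega|u|^p\,dP)^{1/p}$ for $p<\infty$ and $\|u\|_{L^\infty(\Omega)}=\operatorname{ess\,sup}_{\omega}|u(\omega)|$. A family $(r_\varepsilon)_{\varepsilon\in(0,1]}$ of numbers is moderate if $\exists a\ge 0:\ |r_\varepsilon|=O(\varepsilon^{-a})$ as $\varepsilon\to0$, and negligible if $\forall b\ge0:\ |r_\varepsilon|=O(\varepsilon^{b})$ as $\varepsilon\to 0$. *)

theory Defs
  imports "HOL-Probability.Probability"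
begin

section \<open>Partial derivatives and smooth functions\<close>

definition partial_deriv :: "'d::finite \<Rightarrow> (real^'d \<Rightarrow> real) \<Rightarrow> real^'d \<Rightarrow> real" where
  "partial_deriv i f x = deriv (\<lambda>t. f (x + t *\<^sub>R axis i 1)) 0"

(* A finite index type carries no order, so the coordinates are enumerated once and for all in
   some order. By the symmetry of higher derivatives the choice is immaterial for smooth
   functions. *)
definition coords :: "'d::finite list" where
  "coords = (SOME is. distinct is \<and> set is = UNIV)"

definition multi_deriv :: "nat^'d::finite \<Rightarrow> (real^'d \<Rightarrow> real) \<Rightarrow> real^'d \<Rightarrow> real" where
  "multi_deriv \<alpha> = foldr (\<lambda>i g. (partial_deriv i ^^ (\<alpha> $ i)) \<circ> g) coords id"

primrec C_k :: "nat \<Rightarrow> (real^'d::finite \<Rightarrow> real) \<Rightarrow> bool" where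
  "C_k 0 f \<longleftrightarrow> continuous_on UNIV f"
| "C_k (Suc k) f \<longleftrightarrow> f differentiable_on UNIV \<and> (\<forall>i. C_k k (partial_deriv i f))"

definition smooth :: "(real^'d::finite \<Rightarrow> real) \<Rightarrow> bool" where
  "smooth f \<longleftrightarrow> (\<forall>k. C_k k f)"

section \<open>Random fields and \<open>L\<^sup>p\<close> norms\<close>

definition random_field :: "'w measure \<Rightarrow> ('x \<Rightarrow> 'w \<Rightarrow> real) \<Rightarrow> bool" where
  "random_field M A \<longleftrightarrow> (\<forall>x. A x \<in> borel_measurable M)"

(* Only used for exponents r > 0. *)
definition ennreal_powr :: "ennreal \<Rightarrow> real \<Rightarrow> ennreal" where
  "ennreal_powr x r = (if x = \<infinity> then \<infinity> else ennreal (enn2real x powr r))"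

(* The norm of the absolute value f = \<bar>u\<bar>. Taking it with values in [0,\<infinity>] covers
   suprema over x of \<bar>u x \<omega>\<bar>, which may be infinite for exceptional \<omega>. *)
definition Lp_norm :: "'w measure \<Rightarrow> ennreal \<Rightarrow> ('w \<Rightarrow> ennreal) \<Rightarrow> ennreal" where
  "Lp_norm M p f =
     (if p = \<infinity> then esssup M f
      else ennreal_powr (\<integral>\<^sup>+ \<omega>. ennreal_powr (f \<omega>) (enn2real p) \<partial>M) (1 / enn2real p))"

definition in_Lp :: "'w measure \<Rightarrow> ennreal \<Rightarrow> ('w \<Rightarrow> real) \<Rightarrow> bool" where
  "in_Lp M p u \<longleftrightarrow> u \<in> borel_measurable M \<and> Lp_norm M p (\<lambda>\<omega>. ennreal \<bar>u \<omega>\<bar>) < \<infinity>"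

section \<open>Moderate and negligible families\<close>

(* The families are nonnegative and a priori valued in [0,\<infinity>]; being a family of numbers,
   that is, finiteness for every \<epsilon> in (0,1], is part of both notions. *)
definition moderate_family :: "(real \<Rightarrow> ennreal) \<Rightarrow> bool" where
  "moderate_family r \<longleftrightarrow> (\<forall>\<epsilon>\<in>{0<..1}. r \<epsilon> < \<infinity>) \<and>
     (\<exists>a\<ge>0. (\<lambda>\<epsilon>. enn2real (r \<epsilon>)) \<in> O[at_right 0](\<lambda>\<epsilon>. \<epsilon> powr (- a)))"

definition negligible_family :: "(real \<Rightarrow> ennreal) \<Rightarrow> bool" where
  "negligible_family r \<longleftrightarrow> (\<forall>\<epsilon>\<in>{0<..1}. r \<epsilon> < \<infinity>) \<and>
     (\<forall>b\<ge>0. (\<lambda>\<epsilon>. enn2real (r \<epsilon>)) \<in> O[at_right 0](\<lambda>\<epsilon>. \<epsilon> powr b))"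

section \<open>The two families of seminorms\<close>

(* sup over K of the L^p norms, and L^p norm of the sup over K *)
definition sup_norm_family ::
  "'w measure \<Rightarrow> ennreal \<Rightarrow> (real \<Rightarrow> real^'d::finite \<Rightarrow> 'w \<Rightarrow> real) \<Rightarrow>
   (real^'d) set \<Rightarrow> nat^'d \<Rightarrow> real \<Rightarrow> ennreal" where
  "sup_norm_family M p u K \<alpha> \<epsilon> =
     (SUP x\<in>K. Lp_norm M p (\<lambda>\<omega>. ennreal \<bar>multi_deriv \<alpha> (\<lambda>y. u \<epsilon> y \<omega>) x\<bar>))"

definition norm_sup_family ::
  "'w measure \<Rightarrow> ennreal \<Rightarrow> (real \<Rightarrow> real^'d::finite \<Rightarrow> 'w \<Rightarrow> real) \<Rightarrow>
   (real^'d) set \<Rightarrow> nat^'d \<Rightarrow> real \<Rightarrow> ennreal" where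
  "norm_sup_family M p u K \<alpha> \<epsilon> =
     Lp_norm M p (\<lambda>\<omega>. SUP x\<in>K. ennreal \<bar>multi_deriv \<alpha> (\<lambda>y. u \<epsilon> y \<omega>) x\<bar>)"

end

(* For finite p, iterating the fundamental theorem of calculus over the coordinates dominates
   |f|^r on a box pointwise by iterated integrals of |D^b f|^r, b running over finitely many
   multi-indices; by Tonelli the expectation of this bound is controlled by the supremum over
   the box of the moments of the D^b u. For infinite p the supremum over K is an almost sure
   countable supremum, and completeness makes it measurable. Hence the norm of the supremum over
   K is at most a constant, independent of epsilon, times a finite sum of suprema over a larger
   compact set of norms of higher derivatives. *)
theory Submission
  imports Defs
begin

text \<open>For finite p, norm bounds at each single x do not control the supremum over an
  uncountable set; the price is one more differentiation per coordinate. The one-dimensional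
  inequality is stated for r-th powers from the start: every step is then additive in the moments,
  and the expectation moves inside by Tonelli without a further norm inequality. Each differentiated
  field must again be of the form \<open>multi_deriv\<close>, which applies the coordinates in a
  fixed order; this forces the symmetry of mixed derivatives. Tonelli needs joint measurability in
  (x, \<omega>), which comes from continuity in x. For infinite p, sup and \<open>esssup\<close> can
  be exchanged with no derivative lost. The obstacle there is that \<open>esssup\<close> of a
  nonmeasurable function is top, so the supremum must be shown measurable; for finite p a measurable
  majorant suffices.\<close>

lemma ennreal_powr_ennreal:
  "0 \<le> a \<Longrightarrow> ennreal_powr (ennreal a) r = ennreal (a powr r)"
  by (simp add: ennreal_powr_def)

lemma ennreal_powr_mono:
  assumes "x \<le> y" "0 \<le> r"
  shows "ennreal_powr x r \<le> ennreal_powr y r"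
proof (cases "y = \<infinity>")
  case False
  then have "x \<noteq> \<infinity>" using assms by (auto simp: top_unique)
  moreover have "enn2real x \<le> enn2real y"
    using assms False by (intro enn2real_mono) (auto simp: top.not_eq_extremum)
  ultimately show ?thesis
    using False assms by (auto simp: ennreal_powr_def intro!: ennreal_leI powr_mono2)
qed (simp add: ennreal_powr_def)

lemma ennreal_powr_powr:
  "0 \<le> r \<Longrightarrow> 0 \<le> s \<Longrightarrow> r * s = 1 \<Longrightarrow> ennreal_powr (ennreal_powr x r) s = x"
  by (cases x) (auto simp: ennreal_powr_def powr_powr)

section \<open>The one-dimensional inequality\<close>

text \<open>A Sobolev-type bound: f t is f a plus the integral of its derivative g, and the r-th
  power is absorbed by a bound on \<bar>g\<bar> that is affine in its r-th power.\<close>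

lemma powr_le_integral_powr_deriv:
  fixes f g :: "real \<Rightarrow> real"
  assumes "1 \<le> r" "a \<le> t" "t \<le> b"
    and deriv: "\<And>s. (f has_real_derivative g s) (at s)"
    and cont: "continuous_on UNIV g"
  shows "ennreal (\<bar>f t\<bar> powr r) \<le> ennreal ((b - a + 2) powr r) *
    (ennreal (\<bar>f a\<bar> powr r) + (\<integral>\<^sup>+s. ennreal (\<bar>g s\<bar> powr r) * indicator {a..b} s \<partial>lborel))"
proof -
  define k where "k s = \<bar>g s\<bar> powr r" for s
  define J where "J = integral {a..b} k"
  have [continuous_intros]: "continuous_on S g" for S
    using cont continuous_on_subset by blast
  have k[continuous_intros]: "continuous_on S k" for S
    unfolding k_def using \<open>1 \<le> r\<close> by (intro continuous_on_powr' continuous_intros) auto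
  have k_int: "k integrable_on {a..b}"
    by (intro integrable_continuous_interval continuous_intros)
  have "J \<ge> 0" unfolding J_def by (rule integral_nonneg[OF k_int]) (simp add: k_def)
  have nn: "(\<integral>\<^sup>+s. ennreal (k s) * indicator {a..b} s \<partial>lborel) = ennreal J"
    unfolding J_def
    by (rule nn_integral_has_integral_lebesgue') (auto intro: integrable_integral k_int, simp add: k_def)
  have *: "\<bar>f t\<bar> powr r \<le> (b - a + 2) powr r * (\<bar>f a\<bar> powr r + J + e)" if "e > 0" for e
  proof -
    \<comment> \<open>Splitting by \<open>\<bar>g\<bar> \<le> m + \<bar>g\<bar> powr r * m powr (1 - r)\<close> at the level \<open>m\<close> with \<open>m powr r = W\<close>
      replaces Hoelder's inequality; \<open>e\<close> keeps \<open>m\<close> positive.\<close>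
    define W where "W = \<bar>f a\<bar> powr r + J + e"
    have "W > 0" unfolding W_def using \<open>J \<ge> 0\<close> that by (simp add: add_nonneg_pos)
    define m where "m = W powr (1 / r)"
    have "m > 0" using \<open>W > 0\<close> by (simp add: m_def)
    have m_r: "m powr r = W" unfolding m_def using \<open>W > 0\<close> \<open>1 \<le> r\<close> by (simp add: powr_powr)
    define h where "h s = m + k s * m powr (1 - r)" for s
    have g_le: "\<bar>g s\<bar> \<le> h s" for s
    proof (cases "\<bar>g s\<bar> \<le> m")
      case True
      then show ?thesis unfolding h_def k_def by (simp add: add_increasing2)
    next
      case False
      then have "\<bar>g s\<bar> = k s * \<bar>g s\<bar> powr (1 - r)"
        unfolding k_def using \<open>m > 0\<close> by (simp flip: powr_add)
      also have "\<dots> \<le> k s * m powr (1 - r)"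
        using False \<open>m > 0\<close> \<open>1 \<le> r\<close>
        by (intro mult_left_mono powr_mono2') (auto simp: k_def)
      finally show ?thesis unfolding h_def using \<open>m > 0\<close> by simp
    qed
    have h[continuous_intros]: "continuous_on S h" for S
      unfolding h_def by (intro continuous_intros)
    have "(g has_integral (f t - f a)) {a..t}"
      using \<open>a \<le> t\<close> deriv
      by (intro fundamental_theorem_of_calculus)
        (auto simp: has_real_derivative_iff_has_vector_derivative intro: has_vector_derivative_at_within)
    then have "\<bar>f t - f a\<bar> = norm (integral {a..t} g)"
      by (simp add: integral_unique)
    also have "\<dots> \<le> integral {a..t} h"
      using g_le by (intro Henstock_Kurzweil_Integration.integral_norm_bound_integral integrable_continuous_interval continuous_intros) auto
    also have "\<dots> \<le> integral {a..b} h"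
      using \<open>t \<le> b\<close> \<open>m > 0\<close>
      by (intro integral_subset_le integrable_continuous_interval continuous_intros)
        (auto simp: h_def k_def)
    also have "\<dots> = (b - a) * m + J * m powr (1 - r)"
      unfolding h_def J_def using assms(2,3) k_int
      by (subst Henstock_Kurzweil_Integration.integral_add) (auto intro: integrable_on_mult_left)
    also have "J * m powr (1 - r) \<le> W * m powr (1 - r)"
      unfolding W_def using that by (intro mult_right_mono) auto
    also have "\<dots> = m"
      using \<open>m > 0\<close> by (simp flip: m_r powr_add)
    finally have 1: "\<bar>f t - f a\<bar> \<le> (b - a) * m + m" by simp
    have "\<bar>f a\<bar> powr r \<le> m powr r"
      unfolding m_r W_def using \<open>J \<ge> 0\<close> that by simp
    then have "\<bar>f a\<bar> \<le> m"
      using powr_less_mono2[of r m "\<bar>f a\<bar>"] \<open>m > 0\<close> \<open>1 \<le> r\<close> by linarith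
    \<comment> \<open>The factor b - a + 2 collects (b - a) * m from the constant part of
      \<open>h\<close>, m from its integral part, and m from the bound on f a.\<close>
    with 1 have "\<bar>f t\<bar> \<le> (b - a + 2) * m" by (simp add: algebra_simps)
    then have "\<bar>f t\<bar> powr r \<le> ((b - a + 2) * m) powr r"
      using \<open>1 \<le> r\<close> by (intro powr_mono2) auto
    also have "\<dots> = (b - a + 2) powr r * W"
      using \<open>m > 0\<close> assms(2,3) by (simp add: powr_mult m_r)
    finally show ?thesis unfolding W_def .
  qed
  have "\<bar>f t\<bar> powr r \<le> (b - a + 2) powr r * (\<bar>f a\<bar> powr r + J)"
  proof (rule tendsto_lowerbound)
    show "((\<lambda>e. (b - a + 2) powr r * (\<bar>f a\<bar> powr r + J + e)) \<longlongrightarrow>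
        (b - a + 2) powr r * (\<bar>f a\<bar> powr r + J)) (at_right 0)"
      by (rule tendsto_eq_intros refl)+ simp
    show "\<forall>\<^sub>F e in at_right 0. \<bar>f t\<bar> powr r \<le> (b - a + 2) powr r * (\<bar>f a\<bar> powr r + J + e)"
      using * by (auto simp: eventually_at_right_less intro: eventually_mono[OF eventually_at_right_less])
  qed simp
  then have "ennreal (\<bar>f t\<bar> powr r) \<le> ennreal ((b - a + 2) powr r * (\<bar>f a\<bar> powr r + J))"
    by (rule ennreal_leI)
  also have "\<dots> = ennreal ((b - a + 2) powr r) * (ennreal (\<bar>f a\<bar> powr r) + ennreal J)"
    using \<open>J \<ge> 0\<close> by (simp add: ennreal_mult flip: ennreal_plus)
  finally show ?thesis unfolding nn[unfolded k_def] .
qed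

section \<open>Symmetry of mixed derivatives and the calculus of \<open>multi_deriv\<close>\<close>

text \<open>Mean value theorem in s for F s h - F s 0, then in t for F1 at the point found.\<close>

lemma mixed_difference_mvt:
  fixes F :: "real \<Rightarrow> real \<Rightarrow> real"
  assumes "\<And>s t. ((\<lambda>s. F s t) has_real_derivative F1 s t) (at s)"
    and "\<And>s t. ((\<lambda>t. F1 s t) has_real_derivative F12 s t) (at t)"
    and "0 < h"
  obtains s t where "0 < s" "s < h" "0 < t" "t < h"
    "F h h - F h 0 - F 0 h + F 0 0 = h * h * F12 s t"
proof -
  have "\<exists>s. 0 < s \<and> s < h \<and> (F h h - F h 0) - (F 0 h - F 0 0) = (h - 0) * (F1 s h - F1 s 0)"
    using \<open>0 < h\<close> by (intro MVT2 DERIV_diff assms(1))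
  then obtain s where s: "0 < s" "s < h" "(F h h - F h 0) - (F 0 h - F 0 0) = h * (F1 s h - F1 s 0)"
    by auto
  have "\<exists>t. 0 < t \<and> t < h \<and> F1 s h - F1 s 0 = (h - 0) * F12 s t"
    using \<open>0 < h\<close> by (intro MVT2 assms(2))
  then obtain t where "0 < t" "t < h" "F1 s h - F1 s 0 = h * F12 s t" by auto
  with s have "F h h - F h 0 - F 0 h + F 0 0 = h * h * F12 s t" by (simp add: algebra_simps)
  with s \<open>0 < t\<close> \<open>t < h\<close> show ?thesis using that by blast
qed

text \<open>Schwarz's theorem: both mixed derivatives are limits of the same second difference
  quotient over shrinking squares.\<close>

lemma mixed_derivatives_eq:
  fixes F :: "real \<Rightarrow> real \<Rightarrow> real"
  assumes "\<And>s t. ((\<lambda>s. F s t) has_real_derivative F1 s t) (at s)"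
    and "\<And>s t. ((\<lambda>t. F s t) has_real_derivative F2 s t) (at t)"
    and "\<And>s t. ((\<lambda>t. F1 s t) has_real_derivative F12 s t) (at t)"
    and "\<And>s t. ((\<lambda>s. F2 s t) has_real_derivative F21 s t) (at s)"
    and "continuous_on UNIV (\<lambda>(s, t). F12 s t)" "continuous_on UNIV (\<lambda>(s, t). F21 s t)"
  shows "F12 0 0 = F21 0 0"
proof -
  define h where "h n = 1 / real (Suc n)" for n
  have h: "h n > 0" for n by (simp add: h_def)
  have h0: "h \<longlonglongrightarrow> 0" unfolding h_def by (rule LIMSEQ_Suc[OF lim_1_over_n])
  have "\<exists>s t s' t'. \<bar>s\<bar> \<le> h n \<and> \<bar>t\<bar> \<le> h n \<and> \<bar>s'\<bar> \<le> h n \<and> \<bar>t'\<bar> \<le> h n \<and> F12 s t = F21 s' t'" for n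
  proof -
    obtain s t where 1: "0 < s" "s < h n" "0 < t" "t < h n"
      "F (h n) (h n) - F (h n) 0 - F 0 (h n) + F 0 0 = h n * h n * F12 s t"
      using mixed_difference_mvt[OF assms(1,3) h] by metis
    \<comment> \<open>The second difference is symmetric in the two variables, so exchanging their
      roles keeps it and yields F21, in general at another point.\<close>
    obtain t' s' where 2: "0 < t'" "t' < h n" "0 < s'" "s' < h n"
      "F (h n) (h n) - F 0 (h n) - F (h n) 0 + F 0 0 = h n * h n * F21 s' t'"
      using mixed_difference_mvt[of "\<lambda>t s. F s t" "\<lambda>t s. F2 s t" "\<lambda>t s. F21 s t", OF assms(2,4) h] by metis
    have "h n * h n * F12 s t = h n * h n * F21 s' t'" using 1(5) 2(5) by linarith
    then have "F12 s t = F21 s' t'" using h[of n] by simp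
    with 1 2 show ?thesis by (intro exI[of _ s] exI[of _ t] exI[of _ s'] exI[of _ t']) simp
  qed
  then obtain s t s' t' where bnd: "\<And>n. \<bar>s n\<bar> \<le> h n" "\<And>n. \<bar>t n\<bar> \<le> h n"
      "\<And>n. \<bar>s' n\<bar> \<le> h n" "\<And>n. \<bar>t' n\<bar> \<le> h n"
    and eq: "\<And>n. F12 (s n) (t n) = F21 (s' n) (t' n)" by metis
  have lim: "x \<longlonglongrightarrow> 0" if "\<And>n. \<bar>x n\<bar> \<le> h n" for x
    by (rule Lim_null_comparison[OF _ h0]) (use that in auto)
  have "(\<lambda>n. F12 (s n) (t n)) \<longlonglongrightarrow> F12 0 0"
    using continuous_on_tendsto_compose[OF assms(5) tendsto_Pair[OF lim[OF bnd(1)] lim[OF bnd(2)]]] by simp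
  moreover have "(\<lambda>n. F21 (s' n) (t' n)) \<longlonglongrightarrow> F21 0 0"
    using continuous_on_tendsto_compose[OF assms(6) tendsto_Pair[OF lim[OF bnd(3)] lim[OF bnd(4)]]] by simp
  ultimately show ?thesis unfolding eq by (rule LIMSEQ_unique)
qed

lemma smooth_partial_deriv: "smooth f \<Longrightarrow> smooth (partial_deriv i f)"
  unfolding smooth_def using C_k.simps(2)[of _ f] by blast

lemma smooth_partial_deriv_funpow: "smooth f \<Longrightarrow> smooth ((partial_deriv i ^^ n) f)"
  by (induction n) (auto intro: smooth_partial_deriv)

lemma smooth_continuous_on: "smooth f \<Longrightarrow> continuous_on S f"
  unfolding smooth_def using C_k.simps(1)[of f] continuous_on_subset[of UNIV f S] by blast

text \<open>\<open>partial_deriv\<close> is a derivative at parameter 0; taking the base point at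
  parameter t and translating back gives the derivative along the whole line.\<close>

lemma smooth_has_partial_deriv:
  fixes f :: "real^'d::finite \<Rightarrow> real"
  assumes "smooth f"
  shows "((\<lambda>t. f (x + t *\<^sub>R axis i 1)) has_real_derivative partial_deriv i f (x + t *\<^sub>R axis i 1)) (at t)"
proof -
  define y where "y = x + t *\<^sub>R axis i (1::real)"
  have "C_k (Suc 0) f" using assms unfolding smooth_def by blast
  then have "f differentiable (at y)" by (simp add: differentiable_on_def)
  moreover have "(\<lambda>s. y + s *\<^sub>R axis i 1) differentiable (at (0::real))"
    by simp
  ultimately have "(\<lambda>s. f (y + s *\<^sub>R axis i 1)) differentiable (at (0::real))"
    using differentiable_chain_at[of "\<lambda>s. y + s *\<^sub>R axis i 1" 0 f] by (simp add: o_def)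
  then have "((\<lambda>s. f (y + s *\<^sub>R axis i 1)) has_real_derivative partial_deriv i f y) (at (t - t))"
    unfolding partial_deriv_def
    by (simp add: DERIV_deriv_iff_real_differentiable)
  then have "((\<lambda>s. f (y + (s - t) *\<^sub>R axis i 1)) has_real_derivative partial_deriv i f y) (at t)"
    using DERIV_shift[of "\<lambda>s. f (y + (s - t) *\<^sub>R axis i 1)" "partial_deriv i f y" 0 t] by simp
  then show ?thesis by (simp add: y_def algebra_simps)
qed

text \<open>Reduces to \<open>mixed_derivatives_eq\<close> for the two-parameter map (s, t) to f (x
  + s e_j + t e_i), whose second derivatives are continuous by smoothness.\<close>

lemma partial_deriv_commute:
  fixes f :: "real^'d::finite \<Rightarrow> real"
  assumes "smooth f"
  shows "partial_deriv i (partial_deriv j f) = partial_deriv j (partial_deriv i f)"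
proof
  fix x
  let ?p = "\<lambda>s t. x + s *\<^sub>R axis j 1 + t *\<^sub>R axis i (1::real)"
  have c: "continuous_on UNIV (\<lambda>(s, t). g (?p s t))" if "smooth g" for g
    unfolding case_prod_beta
    by (intro continuous_on_compose2[OF smooth_continuous_on[OF that, of UNIV]] continuous_intros) auto
  have D1: "((\<lambda>s. g (?p s t)) has_real_derivative partial_deriv j g (?p s t)) (at s)"
    if "smooth g" for g s t
    using smooth_has_partial_deriv[OF that, of "x + t *\<^sub>R axis i 1" j s]
    by (simp add: add.assoc add.commute add.left_commute)
  have D2: "((\<lambda>t. g (?p s t)) has_real_derivative partial_deriv i g (?p s t)) (at t)"
    if "smooth g" for g s t
    by (rule smooth_has_partial_deriv[OF that])
  have "partial_deriv i (partial_deriv j f) (?p 0 0) = partial_deriv j (partial_deriv i f) (?p 0 0)"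
    by (rule mixed_derivatives_eq[of "\<lambda>s t. f (?p s t)" "\<lambda>s t. partial_deriv j f (?p s t)"
          "\<lambda>s t. partial_deriv i f (?p s t)" "\<lambda>s t. partial_deriv i (partial_deriv j f) (?p s t)"
          "\<lambda>s t. partial_deriv j (partial_deriv i f) (?p s t)",
          OF D1[OF assms] D2[OF assms] D2[OF smooth_partial_deriv[OF assms]]
            D1[OF smooth_partial_deriv[OF assms]] c[OF smooth_partial_deriv[OF smooth_partial_deriv[OF assms]]]
            c[OF smooth_partial_deriv[OF smooth_partial_deriv[OF assms]]]])
  then show "partial_deriv i (partial_deriv j f) x = partial_deriv j (partial_deriv i f) x" by simp
qed

lemma partial_deriv_funpow_commute:
  assumes "smooth f"
  shows "(partial_deriv j ^^ n) (partial_deriv i f) = partial_deriv i ((partial_deriv j ^^ n) f)"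
  by (induction n)
    (auto simp: partial_deriv_commute[OF smooth_partial_deriv_funpow[OF assms]])

(* multi_deriv with the enumeration of the coordinates as an explicit argument, for induction. *)
definition multi_deriv_along :: "'d list \<Rightarrow> nat^'d::finite \<Rightarrow> (real^'d \<Rightarrow> real) \<Rightarrow> real^'d \<Rightarrow> real" where
  "multi_deriv_along is \<alpha> = foldr (\<lambda>i g. (partial_deriv i ^^ (\<alpha> $ i)) \<circ> g) is id"

lemma multi_deriv_along_Cons:
  "multi_deriv_along (i # is) \<alpha> f = (partial_deriv i ^^ (\<alpha> $ i)) (multi_deriv_along is \<alpha> f)"
  by (simp add: multi_deriv_along_def)

lemma smooth_multi_deriv_along: "smooth f \<Longrightarrow> smooth (multi_deriv_along is \<alpha> f)"
proof (induction "is")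
  case Nil
  then show ?case by (simp add: multi_deriv_along_def)
qed (simp add: multi_deriv_along_Cons smooth_partial_deriv_funpow)

text \<open>The additional derivative arises at the place of i in the list and is commuted outwards
  past the later-applied ones. Distinctness ensures that it arises only once.\<close>

lemma multi_deriv_along_add_axis:
  assumes "smooth f" "distinct is"
  shows "multi_deriv_along is (\<alpha> + axis i 1) f =
    (if i \<in> set is then partial_deriv i (multi_deriv_along is \<alpha> f) else multi_deriv_along is \<alpha> f)"
  using assms(2)
proof (induction "is")
  case Nil
  show ?case by (simp add: multi_deriv_along_def)
next
  case (Cons j js)
  show ?case
  proof (cases "i = j")
    case True
    with Cons show ?thesis by (simp add: multi_deriv_along_Cons axis_def)
  next
    case False
    with Cons show ?thesis
      by (simp add: multi_deriv_along_Cons axis_def partial_deriv_funpow_commute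
          smooth_multi_deriv_along assms(1))
  qed
qed

lemma coords: "distinct (coords :: 'd::finite list)" "set (coords :: 'd list) = UNIV"
  unfolding coords_def using someI_ex[of "\<lambda>is. distinct is \<and> set is = (UNIV :: 'd set)"] finite_distinct_list[of "UNIV :: 'd set"]
  by auto

lemma multi_deriv_eq: "multi_deriv \<alpha> = multi_deriv_along coords \<alpha>"
  by (simp add: multi_deriv_def multi_deriv_along_def)

lemma smooth_multi_deriv: "smooth f \<Longrightarrow> smooth (multi_deriv \<alpha> f)"
  by (simp add: multi_deriv_eq smooth_multi_deriv_along)

text \<open>The derivatives \<open>multi_deriv \<alpha> f\<close> are thus closed under every
  \<open>partial_deriv i\<close>, whatever order \<open>coords\<close> has; the induction over
  coordinates relies on it.\<close>

lemma partial_deriv_multi_deriv: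
  "smooth f \<Longrightarrow> partial_deriv i (multi_deriv \<alpha> f) = multi_deriv (\<alpha> + axis i 1) f"
  by (simp add: multi_deriv_eq multi_deriv_along_add_axis[of _ _ _ i, unfolded One_nat_def] coords)

section \<open>Joint measurability and the dominating field\<close>

text \<open>Rounding x down to a grid of mesh 1 / (n + 1) gives countably valued approximations of
  x, along which v is jointly measurable; continuity in x passes this to the limit.\<close>

lemma caratheodory_borel_measurable:
  fixes v :: "real^'d::finite \<Rightarrow> 'w \<Rightarrow> real"
  assumes meas: "\<And>x. v x \<in> borel_measurable M"
    and cont: "\<And>\<omega>. \<omega> \<in> space M \<Longrightarrow> continuous_on UNIV (\<lambda>x. v x \<omega>)"
  shows "(\<lambda>(x, \<omega>). v x \<omega>) \<in> borel_measurable (borel \<Otimes>\<^sub>M M)"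
proof -
  \<comment> \<open>The rounded point is indexed by integer vectors, a countable type, so that
    \<open>measurable_compose_countable\<close> applies.\<close>
  define fl :: "nat \<Rightarrow> real^'d \<Rightarrow> int^'d" where "fl n x = (\<chi> i. \<lfloor>real (Suc n) * x $ i\<rfloor>)" for n x
  define q :: "nat \<Rightarrow> int^'d \<Rightarrow> real^'d" where "q n z = (\<chi> i. real_of_int (z $ i) / real (Suc n))" for n z
  have fl: "fl n \<in> borel \<rightarrow>\<^sub>M count_space UNIV" for n
  proof (subst measurable_count_space_eq2_countable, safe)
    fix z
    have "fl n -` {z} \<inter> space borel = {x \<in> space borel. \<forall>i. \<lfloor>real (Suc n) * x $ i\<rfloor> = z $ i}"
      by (auto simp: fl_def vec_eq_iff)
    also have "\<dots> \<in> sets borel" by measurable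
    finally show "fl n -` {z} \<inter> space borel \<in> sets borel" .
  qed auto
  have [measurable]: "v x \<in> borel_measurable M" for x by (rule meas)
  have approx: "(\<lambda>p. v (q n (fl n (fst p))) (snd p)) \<in> borel_measurable (borel \<Otimes>\<^sub>M M)" for n
  proof (rule measurable_compose_countable)
    show "(\<lambda>p. v (q n z) (snd p)) \<in> borel_measurable (borel \<Otimes>\<^sub>M M)" for z by measurable
    show "(\<lambda>p. fl n (fst p)) \<in> borel \<Otimes>\<^sub>M M \<rightarrow>\<^sub>M count_space UNIV"
      by (rule measurable_compose[OF measurable_fst fl])
  qed
  have q: "(\<lambda>n. q n (fl n x)) \<longlonglongrightarrow> x" for x
  proof (rule vec_tendstoI)
    fix i
    have "\<bar>q n (fl n x) $ i - x $ i\<bar> \<le> 1 / real (Suc n)" for n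
    proof -
      have "q n (fl n x) $ i - x $ i = (\<lfloor>real (Suc n) * x $ i\<rfloor> - real (Suc n) * x $ i) / real (Suc n)"
        unfolding q_def fl_def by (simp only: vec_lambda_beta) (simp add: field_simps del: of_nat_Suc)
      also have "\<bar>\<dots>\<bar> \<le> 1 / real (Suc n)"
        unfolding abs_divide abs_of_nat by (intro divide_right_mono) linarith+
      finally show ?thesis .
    qed
    then have "(\<lambda>n. q n (fl n x) $ i - x $ i) \<longlonglongrightarrow> 0"
      by (intro Lim_null_comparison[OF _ LIMSEQ_Suc[OF lim_1_over_n]]) auto
    then show "(\<lambda>n. q n (fl n x) $ i) \<longlonglongrightarrow> x $ i"
      by (simp add: LIM_zero_iff)
  qed
  show ?thesis unfolding case_prod_beta
  proof (rule borel_measurable_LIMSEQ_metric[OF approx])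
    fix p :: "(real^'d) \<times> 'w" assume "p \<in> space (borel \<Otimes>\<^sub>M M)"
    then have "snd p \<in> space M" by (auto simp: space_pair_measure)
    show "(\<lambda>n. v (q n (fl n (fst p))) (snd p)) \<longlonglongrightarrow> v (fst p) (snd p)"
      by (rule continuous_on_tendsto_compose[OF cont[OF \<open>snd p \<in> space M\<close>] q]) auto
  qed
qed

definition upd :: "real^'d::finite \<Rightarrow> 'd \<Rightarrow> real \<Rightarrow> real^'d" where
  "upd x i s = (\<chi> k. if k = i then s else x $ k)"

lemma upd_nth: "upd x i s $ k = (if k = i then s else x $ k)"
  by (simp add: upd_def)

lemma upd_same [simp]: "upd x i (x $ i) = x"
  by (simp add: upd_def vec_eq_iff)

text \<open>Substituting a coordinate is motion along an axis, the form in which partial derivatives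
  are available.\<close>

lemma upd_conv_axis: "upd x i t = upd x i 0 + t *\<^sub>R axis i 1"
  by (simp add: upd_def vec_eq_iff axis_def)

lemma continuous_on_upd [continuous_intros]:
  assumes "continuous_on S f" "continuous_on S g"
  shows "continuous_on S (\<lambda>x. upd (f x) i (g x))"
proof -
  have "continuous_on S (\<lambda>x. if k = i then g x else f x $ k)" for k
    using assms by (cases "k = i") (auto intro: continuous_intros)
  then show ?thesis unfolding upd_def by (intro continuous_intros)
qed

lemma measurable_upd [measurable (raw)]:
  assumes "f \<in> borel_measurable N" "g \<in> borel_measurable N"
  shows "(\<lambda>x. upd (f x) i (g x)) \<in> borel_measurable N"
  by (rule borel_measurable_continuous_Pair[OF assms]) (intro continuous_intros)

text \<open>Induction over the coordinates already freed. \<open>T x\<close> dominates the field at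
  every y of the box that differs from x only in the listed coordinates, so its moments are bounded
  without any restriction on those coordinates of x. The allowance \<open>length is\<close> on each
  entry of \<beta> is generous; it keeps the count uniform in the coordinates. The factor c per
  coordinate is that of the one-dimensional inequality times 1 for the endpoint plus b - a for the
  integral.\<close>

lemma exists_dominating_field_along:
  fixes v :: "nat^'d::finite \<Rightarrow> real^'d \<Rightarrow> 'w \<Rightarrow> real"
  assumes "sigma_finite_measure M" "1 \<le> r" "a \<le> b"
    and meas: "\<And>\<gamma> x. v \<gamma> x \<in> borel_measurable M"
    and cont: "\<forall>\<omega>\<in>space M. \<forall>\<gamma>. continuous_on UNIV (\<lambda>x. v \<gamma> x \<omega>)"
    and deriv: "\<forall>\<omega>\<in>space M. \<forall>\<gamma> i x t.
      ((\<lambda>t. v \<gamma> (upd x i t) \<omega>) has_real_derivative v (\<gamma> + axis i 1) (upd x i t) \<omega>) (at t)"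
  defines "c \<equiv> ennreal ((b - a + 2) powr r) * (1 + ennreal (b - a))"
  shows "\<exists>T. (\<lambda>(x, \<omega>). T x \<omega>) \<in> borel_measurable (borel \<Otimes>\<^sub>M M) \<and>
    (\<forall>\<omega>\<in>space M. \<forall>x y. (\<forall>k. y $ k \<in> {a..b}) \<longrightarrow> (\<forall>k. k \<notin> set is \<longrightarrow> y $ k = x $ k) \<longrightarrow>
      ennreal (\<bar>v \<gamma> y \<omega>\<bar> powr r) \<le> T x \<omega>) \<and>
    (\<forall>D. (\<forall>\<beta> x. (\<forall>k. \<beta> $ k \<le> \<gamma> $ k + length is) \<longrightarrow> (\<forall>k. x $ k \<in> {a..b}) \<longrightarrow>
        (\<integral>\<^sup>+\<omega>. ennreal (\<bar>v \<beta> x \<omega>\<bar> powr r) \<partial>M) \<le> D) \<longrightarrow>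
      (\<forall>x. (\<forall>k. k \<notin> set is \<longrightarrow> x $ k \<in> {a..b}) \<longrightarrow> (\<integral>\<^sup>+\<omega>. T x \<omega> \<partial>M) \<le> c ^ length is * D))"
proof (induction "is" arbitrary: \<gamma>)
  case Nil
  \<comment> \<open>With no coordinate freed, y equals x and the r-th power of the field dominates
    itself.\<close>
  have "(\<lambda>(x, \<omega>). v \<gamma> x \<omega>) \<in> borel_measurable (borel \<Otimes>\<^sub>M M)"
    by (rule caratheodory_borel_measurable[OF meas cont[rule_format]])
  then have "(\<lambda>(x, \<omega>). ennreal (\<bar>v \<gamma> x \<omega>\<bar> powr r)) \<in> borel_measurable (borel \<Otimes>\<^sub>M M)"
    by measurable
  then show ?case
    by (intro exI[of _ "\<lambda>x \<omega>. ennreal (\<bar>v \<gamma> x \<omega>\<bar> powr r)"]) (auto simp flip: vec_eq_iff)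
next
  case (Cons i js)
  interpret M: sigma_finite_measure M by fact
  interpret P: pair_sigma_finite M lborel ..
  let ?C = "ennreal ((b - a + 2) powr r)"
  \<comment> \<open>\<open>T0\<close> will bound the value at the endpoint a of coordinate i,
    \<open>T1\<close> below the derivative under the integral.\<close>
  obtain T0 where T0_meas: "(\<lambda>(x, \<omega>). T0 x \<omega>) \<in> borel_measurable (borel \<Otimes>\<^sub>M M)"
    and T0_dom: "\<And>\<omega> x y. \<omega> \<in> space M \<Longrightarrow> (\<forall>k. y $ k \<in> {a..b}) \<Longrightarrow>
      (\<forall>k. k \<notin> set js \<longrightarrow> y $ k = x $ k) \<Longrightarrow> ennreal (\<bar>v \<gamma> y \<omega>\<bar> powr r) \<le> T0 x \<omega>"
    and T0_int: "\<And>D x. (\<forall>\<beta> x. (\<forall>k. \<beta> $ k \<le> \<gamma> $ k + length js) \<longrightarrow> (\<forall>k. x $ k \<in> {a..b}) \<longrightarrow>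
        (\<integral>\<^sup>+\<omega>. ennreal (\<bar>v \<beta> x \<omega>\<bar> powr r) \<partial>M) \<le> D) \<Longrightarrow>
      (\<forall>k. k \<notin> set js \<longrightarrow> x $ k \<in> {a..b}) \<Longrightarrow> (\<integral>\<^sup>+\<omega>. T0 x \<omega> \<partial>M) \<le> c ^ length js * D"
    using Cons.IH[of \<gamma>] by blast
  let ?\<delta> = "\<gamma> + axis i 1"
  obtain T1 where T1_meas: "(\<lambda>(x, \<omega>). T1 x \<omega>) \<in> borel_measurable (borel \<Otimes>\<^sub>M M)"
    and T1_dom: "\<And>\<omega> x y. \<omega> \<in> space M \<Longrightarrow> (\<forall>k. y $ k \<in> {a..b}) \<Longrightarrow>
      (\<forall>k. k \<notin> set js \<longrightarrow> y $ k = x $ k) \<Longrightarrow> ennreal (\<bar>v ?\<delta> y \<omega>\<bar> powr r) \<le> T1 x \<omega>"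
    and T1_int: "\<And>D x. (\<forall>\<beta> x. (\<forall>k. \<beta> $ k \<le> ?\<delta> $ k + length js) \<longrightarrow> (\<forall>k. x $ k \<in> {a..b}) \<longrightarrow>
        (\<integral>\<^sup>+\<omega>. ennreal (\<bar>v \<beta> x \<omega>\<bar> powr r) \<partial>M) \<le> D) \<Longrightarrow>
      (\<forall>k. k \<notin> set js \<longrightarrow> x $ k \<in> {a..b}) \<Longrightarrow> (\<integral>\<^sup>+\<omega>. T1 x \<omega> \<partial>M) \<le> c ^ length js * D"
    using Cons.IH[of ?\<delta>] by blast
  \<comment> \<open>Restates joint measurability as a rule for arguments that are themselves
    functions, as needed for substituted points.\<close>
  note [measurable (raw)] = measurable_compose[OF measurable_Pair T0_meas, unfolded prod.case]
    measurable_compose[OF measurable_Pair T1_meas, unfolded prod.case]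
  \<comment> \<open>The one-dimensional bound in coordinate i with both terms replaced by their
    majorants; coordinate i of x is overwritten in each.\<close>
  define T where "T x \<omega> = ?C * (T0 (upd x i a) \<omega> +
    (\<integral>\<^sup>+s. T1 (upd x i s) \<omega> * indicator {a..b} s \<partial>lborel))" for x \<omega>
  have "(\<lambda>(x, \<omega>). T x \<omega>) \<in> borel_measurable (borel \<Otimes>\<^sub>M M)"
    unfolding T_def by measurable
  moreover have "ennreal (\<bar>v \<gamma> y \<omega>\<bar> powr r) \<le> T x \<omega>"
    if \<omega>: "\<omega> \<in> space M" and y: "\<forall>k. y $ k \<in> {a..b}" "\<forall>k. k \<notin> set (i # js) \<longrightarrow> y $ k = x $ k"
    for \<omega> x y
  proof -
    \<comment> \<open>Writing y as \<open>upd y i (y $ i)\<close> exhibits it as the point t = y $ i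
      on the line in direction i.\<close>
    have "ennreal (\<bar>v \<gamma> (upd y i (y $ i)) \<omega>\<bar> powr r) \<le> ?C * (ennreal (\<bar>v \<gamma> (upd y i a) \<omega>\<bar> powr r)
        + (\<integral>\<^sup>+s. ennreal (\<bar>v ?\<delta> (upd y i s) \<omega>\<bar> powr r) * indicator {a..b} s \<partial>lborel))"
    proof (rule powr_le_integral_powr_deriv)
      show "continuous_on UNIV (\<lambda>s. v ?\<delta> (upd y i s) \<omega>)"
        by (rule continuous_on_compose2[OF cont[rule_format, OF \<omega>]]) (auto intro: continuous_intros)
    qed (use assms(2) y deriv \<omega> in auto)
    \<comment> \<open>After overwriting coordinate i by the same value, y and x agree outside
      \<open>js\<close>, so the induction hypotheses apply.\<close>
    also have "\<dots> \<le> T x \<omega>"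
      unfolding T_def
    proof (intro mult_left_mono add_mono nn_integral_mono T0_dom[OF \<omega>])
      show "ennreal (\<bar>v ?\<delta> (upd y i s) \<omega>\<bar> powr r) * indicator {a..b} s \<le>
          T1 (upd x i s) \<omega> * indicator {a..b} s" for s
      proof (cases "s \<in> {a..b}")
        case True
        then have "ennreal (\<bar>v ?\<delta> (upd y i s) \<omega>\<bar> powr r) \<le> T1 (upd x i s) \<omega>"
          using y by (intro T1_dom[OF \<omega>]) (auto simp: upd_nth)
        then show ?thesis by (rule mult_right_mono) simp
      qed simp
    qed (use y \<open>a \<le> b\<close> in \<open>auto simp: upd_nth\<close>)
    finally show ?thesis by simp
  qed
  moreover have "(\<integral>\<^sup>+\<omega>. T x \<omega> \<partial>M) \<le> c ^ length (i # js) * D"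
    if D: "\<forall>\<beta> x. (\<forall>k. \<beta> $ k \<le> \<gamma> $ k + length (i # js)) \<longrightarrow> (\<forall>k. x $ k \<in> {a..b}) \<longrightarrow>
        (\<integral>\<^sup>+\<omega>. ennreal (\<bar>v \<beta> x \<omega>\<bar> powr r) \<partial>M) \<le> D"
      and x: "\<forall>k. k \<notin> set (i # js) \<longrightarrow> x $ k \<in> {a..b}" for D x
  proof -
    let ?E = "c ^ length js * D"
    have I0: "(\<integral>\<^sup>+\<omega>. T0 (upd x i a) \<omega> \<partial>M) \<le> ?E"
      using D x \<open>a \<le> b\<close> by (intro T0_int) (auto simp: upd_nth le_SucI)
    \<comment> \<open>The derivative order rises by one in coordinate i only, and the list is longer
      by one.\<close>
    have room: "\<beta> $ k \<le> \<gamma> $ k + length (i # js)" if "\<beta> $ k \<le> ?\<delta> $ k + length js" for \<beta> :: "nat^'d" and k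
      using that by (simp add: axis_def split: if_splits)
    have I1: "(\<integral>\<^sup>+\<omega>. T1 (upd x i s) \<omega> \<partial>M) \<le> ?E" if "s \<in> {a..b}" for s
    proof (rule T1_int)
      show "\<forall>\<beta> x. (\<forall>k. \<beta> $ k \<le> ?\<delta> $ k + length js) \<longrightarrow> (\<forall>k. x $ k \<in> {a..b}) \<longrightarrow>
        (\<integral>\<^sup>+\<omega>. ennreal (\<bar>v \<beta> x \<omega>\<bar> powr r) \<partial>M) \<le> D"
        using D room by blast
    qed (use x that in \<open>auto simp: upd_nth\<close>)
    have "(\<integral>\<^sup>+\<omega>. T x \<omega> \<partial>M) = ?C * ((\<integral>\<^sup>+\<omega>. T0 (upd x i a) \<omega> \<partial>M) +
        (\<integral>\<^sup>+\<omega>. (\<integral>\<^sup>+s. T1 (upd x i s) \<omega> * indicator {a..b} s \<partial>lborel) \<partial>M))"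
      unfolding T_def by (subst nn_integral_cmult, measurable, subst nn_integral_add, measurable)
    also have "(\<integral>\<^sup>+\<omega>. (\<integral>\<^sup>+s. T1 (upd x i s) \<omega> * indicator {a..b} s \<partial>lborel) \<partial>M) =
        (\<integral>\<^sup>+s. (\<integral>\<^sup>+\<omega>. T1 (upd x i s) \<omega> * indicator {a..b} s \<partial>M) \<partial>lborel)"
      by (rule P.Fubini'[symmetric]) measurable
    also have "\<dots> = (\<integral>\<^sup>+s. (\<integral>\<^sup>+\<omega>. T1 (upd x i s) \<omega> \<partial>M) * indicator {a..b} s \<partial>lborel)"
      by (intro nn_integral_cong nn_integral_multc) measurable
    also have "\<dots> \<le> (\<integral>\<^sup>+s. ?E * indicator {a..b} s \<partial>lborel)"
      by (intro nn_integral_mono) (auto simp: indicator_def I1)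
    also have "\<dots> = ?E * ennreal (b - a)"
      using \<open>a \<le> b\<close> by (simp add: nn_integral_cmult_indicator)
    finally have "(\<integral>\<^sup>+\<omega>. T x \<omega> \<partial>M) \<le> ?C * (?E + ?E * ennreal (b - a))"
      using I0 by (meson add_mono mult_left_mono order_refl order_trans zero_le)
    also have "\<dots> = c ^ length (i # js) * D"
      unfolding c_def by (simp add: algebra_simps)
    finally show ?thesis .
  qed
  ultimately show ?case by (intro exI[of _ T]) blast
qed

section \<open>The supremum under the norm for finite p\<close>

lemma Lp_norm_finite_exponent:
  assumes "1 \<le> p" "p \<noteq> \<infinity>"
  shows "1 \<le> enn2real p"
    and "Lp_norm M p f = ennreal_powr (\<integral>\<^sup>+\<omega>. ennreal_powr (f \<omega>) (enn2real p) \<partial>M) (1 / enn2real p)"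
  using assms by (cases p; simp add: Lp_norm_def)+

lemma ennreal_powr_le_iff:
  assumes "0 \<le> r" "0 \<le> s" "r * s = 1"
  shows "ennreal_powr x r \<le> y \<longleftrightarrow> x \<le> ennreal_powr y s"
  by (metis assms ennreal_powr_mono ennreal_powr_powr mult.commute)

lemma Lp_norm_SUP_le_finite_exponent:
  fixes f :: "'w \<Rightarrow> real^'d::finite \<Rightarrow> real"
  assumes "prob_space M" "1 \<le> p" "p \<noteq> \<infinity>" "a \<le> b"
    and smooth: "AE \<omega> in M. smooth (f \<omega>)"
    and meas: "\<And>\<beta> x. (\<lambda>\<omega>. multi_deriv \<beta> (f \<omega>) x) \<in> borel_measurable M"
    and D: "\<And>\<beta> x. (\<forall>k. \<beta> $ k \<le> \<alpha> $ k + CARD('d)) \<Longrightarrow> (\<forall>k. x $ k \<in> {a..b}) \<Longrightarrow>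
      Lp_norm M p (\<lambda>\<omega>. ennreal \<bar>multi_deriv \<beta> (f \<omega>) x\<bar>) \<le> ennreal D" "0 \<le> D"
    and K: "\<And>x k. x \<in> K \<Longrightarrow> x $ k \<in> {a..b}"
    and r: "r = enn2real p"
  shows "Lp_norm M p (\<lambda>\<omega>. SUP x\<in>K. ennreal \<bar>multi_deriv \<alpha> (f \<omega>) x\<bar>) \<le>
    ennreal ((((b - a + 2) powr r * (1 + (b - a))) ^ CARD('d)) powr (1 / r) * D)"
proof -
  interpret prob_space M by fact
  have r1: "1 \<le> r" and Lp: "\<And>h. Lp_norm M p h = ennreal_powr (\<integral>\<^sup>+\<omega>. ennreal_powr (h \<omega>) r \<partial>M) (1 / r)"
    using Lp_norm_finite_exponent[OF assms(2,3)] r by auto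
  obtain N where N: "{\<omega> \<in> space M. \<not> smooth (f \<omega>)} \<subseteq> N" "emeasure M N = 0" "N \<in> sets M"
    using smooth by (rule AE_E)
  \<comment> \<open>The dominating field needs continuity and the derivative relations at every
    \<omega>. The zero field satisfies them on the measurable null set \<open>N\<close>, and the
    change does not affect the moments.\<close>
  define v where "v \<beta> x \<omega> = (if \<omega> \<in> N then 0 else multi_deriv \<beta> (f \<omega>) x)" for \<beta> x \<omega>
  have N_smooth: "smooth (f \<omega>)" if "\<omega> \<in> space M" "\<omega> \<notin> N" for \<omega>
    using N(1) that by auto
  have N_AE: "AE \<omega> in M. \<omega> \<notin> N" using N by (intro AE_not_in) auto
  have v_meas: "v \<beta> x \<in> borel_measurable M" for \<beta> x
    unfolding v_def using meas N(3) by measurable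
  have v_cont: "\<forall>\<omega>\<in>space M. \<forall>\<beta>. continuous_on UNIV (\<lambda>x. v \<beta> x \<omega>)"
  proof (intro ballI allI)
    show "continuous_on UNIV (\<lambda>x. v \<beta> x \<omega>)" if "\<omega> \<in> space M" for \<omega> \<beta>
      using smooth_continuous_on[OF smooth_multi_deriv[OF N_smooth[OF that]]]
      by (cases "\<omega> \<in> N") (simp_all add: v_def)
  qed
  have "((\<lambda>t. v \<beta> (upd x i t) \<omega>) has_real_derivative v (\<beta> + axis i 1) (upd x i t) \<omega>) (at t)"
    if "\<omega> \<in> space M" for \<beta> \<omega> i x t
  proof (cases "\<omega> \<in> N")
    case False
    then have "smooth (f \<omega>)" using N_smooth that by auto
    then have "((\<lambda>t. multi_deriv \<beta> (f \<omega>) (upd x i t)) has_real_derivative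
        multi_deriv (\<beta> + axis i 1) (f \<omega>) (upd x i t)) (at t)"
      using smooth_has_partial_deriv[OF smooth_multi_deriv, of "f \<omega>" \<beta> "upd x i 0" i t]
      by (simp only: partial_deriv_multi_deriv flip: upd_conv_axis)
    with False show ?thesis by (simp add: v_def)
  qed (simp add: v_def)
  then have v_deriv: "\<forall>\<omega>\<in>space M. \<forall>\<beta> i x t.
      ((\<lambda>t. v \<beta> (upd x i t) \<omega>) has_real_derivative v (\<beta> + axis i 1) (upd x i t) \<omega>) (at t)"
    by blast
  let ?c = "(b - a + 2) powr r * (1 + (b - a))"
  have "0 \<le> ?c" using \<open>a \<le> b\<close> by simp
  have c: "ennreal ((b - a + 2) powr r) * (1 + ennreal (b - a)) = ennreal ?c"
    using \<open>a \<le> b\<close> by (simp add: ennreal_mult flip: ennreal_1 ennreal_plus)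
  have length: "length (coords :: 'd list) = CARD('d)"
    using distinct_card[of "coords :: 'd list"] by (simp add: coords)
  have v_D: "(\<integral>\<^sup>+\<omega>. ennreal (\<bar>v \<beta> x \<omega>\<bar> powr r) \<partial>M) \<le> ennreal (D powr r)"
    if "\<forall>k. \<beta> $ k \<le> \<alpha> $ k + CARD('d)" "\<forall>k. x $ k \<in> {a..b}" for \<beta> x
  proof -
    have "(\<integral>\<^sup>+\<omega>. ennreal (\<bar>v \<beta> x \<omega>\<bar> powr r) \<partial>M) =
        (\<integral>\<^sup>+\<omega>. ennreal_powr (ennreal \<bar>multi_deriv \<beta> (f \<omega>) x\<bar>) r \<partial>M)"
      using N_AE by (intro nn_integral_cong_AE) (auto simp: v_def ennreal_powr_ennreal)
    also have "\<dots> \<le> ennreal_powr (ennreal D) r"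
      using D(1)[OF that] r1 unfolding Lp by (subst (asm) ennreal_powr_le_iff[where s = r]) auto
    finally show ?thesis using D(2) by (simp add: ennreal_powr_ennreal)
  qed
  \<comment> \<open>\<open>coords\<close> lists all coordinates, so the conditions on
    \<open>k \<notin> UNIV\<close> are vacuous and the base point x is arbitrary; 0 is used below,
    whether or not it lies in the box.\<close>
  obtain T where T_dom: "\<forall>\<omega>\<in>space M. \<forall>x y. (\<forall>k. y $ k \<in> {a..b}) \<longrightarrow> (\<forall>k. k \<notin> UNIV \<longrightarrow> y $ k = x $ k) \<longrightarrow>
      ennreal (\<bar>v \<alpha> y \<omega>\<bar> powr r) \<le> T x \<omega>"
    and T_int: "\<forall>D. (\<forall>\<beta> x. (\<forall>k. \<beta> $ k \<le> \<alpha> $ k + CARD('d)) \<longrightarrow> (\<forall>k. x $ k \<in> {a..b}) \<longrightarrow>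
        (\<integral>\<^sup>+\<omega>. ennreal (\<bar>v \<beta> x \<omega>\<bar> powr r) \<partial>M) \<le> D) \<longrightarrow>
      (\<forall>x. (\<forall>k. k \<notin> UNIV \<longrightarrow> x $ k \<in> {a..b}) \<longrightarrow> (\<integral>\<^sup>+\<omega>. T x \<omega> \<partial>M) \<le> ennreal ?c ^ CARD('d) * D)"
    using exists_dominating_field_along[OF sigma_finite_measure_axioms r1 \<open>a \<le> b\<close> v_meas v_cont v_deriv,
        of coords \<alpha>, unfolded c length coords(2)]
    by (elim exE conjE) (rule that)
  have T_int: "(\<integral>\<^sup>+\<omega>. T 0 \<omega> \<partial>M) \<le> ennreal ?c ^ CARD('d) * ennreal (D powr r)"
    by (rule T_int[rule_format]) (use v_D in auto)
  \<comment> \<open>\<open>nn_integral\<close> is monotone for arbitrary integrands, so the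
    uncountable supremum enters without a measurability claim.\<close>
  have "(\<integral>\<^sup>+\<omega>. ennreal_powr (SUP x\<in>K. ennreal \<bar>multi_deriv \<alpha> (f \<omega>) x\<bar>) r \<partial>M) \<le> (\<integral>\<^sup>+\<omega>. T 0 \<omega> \<partial>M)"
  proof (rule nn_integral_mono_AE, use N_AE AE_space in eventually_elim)
    case (elim \<omega>)
    have "ennreal \<bar>multi_deriv \<alpha> (f \<omega>) x\<bar> \<le> ennreal_powr (T 0 \<omega>) (1 / r)" if "x \<in> K" for x
    proof (subst ennreal_powr_le_iff[symmetric, of r])
      show "ennreal_powr (ennreal \<bar>multi_deriv \<alpha> (f \<omega>) x\<bar>) r \<le> T 0 \<omega>"
        using T_dom[rule_format, of \<omega> x 0] elim K[OF that] by (simp add: v_def ennreal_powr_ennreal)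
    qed (use r1 in auto)
    then show ?case
      using r1 by (subst ennreal_powr_le_iff[of r "1 / r"]) (auto intro: SUP_least)
  qed
  also have "\<dots> \<le> ennreal (?c ^ CARD('d) * D powr r)"
    using T_int
    by (simp only: ennreal_mult[OF zero_le_power[OF \<open>0 \<le> ?c\<close>] powr_ge_zero] ennreal_power[OF \<open>0 \<le> ?c\<close>])
  finally have "Lp_norm M p (\<lambda>\<omega>. SUP x\<in>K. ennreal \<bar>multi_deriv \<alpha> (f \<omega>) x\<bar>) \<le>
      ennreal_powr (ennreal (?c ^ CARD('d) * D powr r)) (1 / r)"
    unfolding Lp using r1 by (intro ennreal_powr_mono) auto
  also have "\<dots> = ennreal ((?c ^ CARD('d)) powr (1 / r) * D)"
    using \<open>a \<le> b\<close> r1 D(2) by (simp add: ennreal_powr_ennreal powr_mult powr_powr)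
  finally show ?thesis .
qed

section \<open>The supremum under the norm for infinite p\<close>

lemma esssup_SUP_le:
  fixes g :: "'x::{metric_space, second_countable_topology} \<Rightarrow> 'w \<Rightarrow> real"
  assumes "complete_measure M"
    and meas: "\<And>x. g x \<in> borel_measurable M"
    and cont: "AE \<omega> in M. continuous_on K (\<lambda>x. g x \<omega>)"
    and D: "\<And>x. x \<in> K \<Longrightarrow> esssup M (\<lambda>\<omega>. ennreal \<bar>g x \<omega>\<bar>) \<le> D"
  shows "esssup M (\<lambda>\<omega>. SUP x\<in>K. ennreal \<bar>g x \<omega>\<bar>) \<le> D"
proof -
  interpret complete_measure M by fact
  obtain C where C: "countable C" "C \<subseteq> K" "K \<subseteq> closure C" by (rule separable)
  define S where "S A \<omega> = (SUP x\<in>A. ennreal \<bar>g x \<omega>\<bar>)" for A \<omega>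
  have [measurable]: "g x \<in> borel_measurable M" for x by (rule meas)
  have S_C[measurable]: "S C \<in> borel_measurable M"
    unfolding S_def using C(1) by measurable
  \<comment> \<open>Almost every path is continuous on K, so a bound on the dense set
    \<open>C\<close> extends to K.\<close>
  have le: "S K \<omega> \<le> z" if "continuous_on K (\<lambda>x. g x \<omega>)" "S C \<omega> \<le> z" for \<omega> z
    unfolding S_def
  proof (rule SUP_least)
    fix x assume x: "x \<in> K"
    then obtain y where y: "\<And>n. y n \<in> C" "y \<longlonglongrightarrow> x"
      using C(3) closure_sequential by blast
    have "(\<lambda>n. g (y n) \<omega>) \<longlonglongrightarrow> g x \<omega>"
      using that(1) y C(2) x
      by (intro continuous_on_tendsto_compose[of K "\<lambda>x. g x \<omega>"] always_eventually) auto
    then have lim: "(\<lambda>n. ennreal \<bar>g (y n) \<omega>\<bar>) \<longlonglongrightarrow> ennreal \<bar>g x \<omega>\<bar>"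
      by (intro tendsto_ennrealI tendsto_rabs)
    have "ennreal \<bar>g (y n) \<omega>\<bar> \<le> z" for n
      using that(2) y(1) unfolding S_def by (meson SUP_upper order_trans)
    then show "ennreal \<bar>g x \<omega>\<bar> \<le> z" by (intro LIMSEQ_le_const2[OF lim]) blast
  qed
  have eq: "AE \<omega> in M. S C \<omega> = S K \<omega>"
    using cont
  proof eventually_elim
    case (elim \<omega>)
    have "S C \<omega> \<le> S K \<omega>" unfolding S_def using C(2) by (rule SUP_subset_mono) simp
    with le[OF elim order_refl] show ?case by (rule antisym[rotated])
  qed
  \<comment> \<open>\<open>S K\<close> agrees with the countable supremum \<open>S C\<close> off a
    null set. By completeness, sets that differ from measurable ones only there are measurable
    too.\<close>
  have "S K \<in> borel_measurable M"
  proof (rule measurableI)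
    fix A :: "ennreal set" assume A: "A \<in> sets borel"
    show "S K -` A \<inter> space M \<in> sets M"
    proof (rule in_sets_AE)
      show "AE \<omega> in M. \<omega> \<in> S C -` A \<inter> space M \<longleftrightarrow> \<omega> \<in> S K -` A \<inter> space M"
        using eq by eventually_elim simp
    qed (use A in \<open>auto intro: measurable_sets\<close>)
  qed simp
  moreover have "AE \<omega> in M. \<forall>x\<in>C. ennreal \<bar>g x \<omega>\<bar> \<le> D"
    unfolding AE_ball_countable[OF C(1)]
  proof
    fix x assume "x \<in> C"
    have "AE \<omega> in M. ennreal \<bar>g x \<omega>\<bar> \<le> esssup M (\<lambda>\<omega>. ennreal \<bar>g x \<omega>\<bar>)"
      by (rule esssup_AE)
    then show "AE \<omega> in M. ennreal \<bar>g x \<omega>\<bar> \<le> D"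
      by eventually_elim (use D \<open>x \<in> C\<close> C(2) in \<open>blast intro: order_trans\<close>)
  qed
  then have "AE \<omega> in M. S K \<omega> \<le> D"
    using cont
  proof eventually_elim
    case (elim \<omega>)
    then have "S C \<omega> \<le> D" unfolding S_def by (intro SUP_least) blast
    then show ?case by (rule le[OF elim(2)])
  qed
  ultimately show ?thesis unfolding S_def by (rule esssup_I)
qed

text \<open>Meant for g a supremum over K. If g is not measurable, its \<open>esssup\<close> is top
  and the infinite case still holds.\<close>

lemma Lp_norm_mono:
  assumes "1 \<le> p" "f \<in> borel_measurable M" "\<And>\<omega>. f \<omega> \<le> g \<omega>"
  shows "Lp_norm M p f \<le> Lp_norm M p g"
proof (cases "p = \<infinity>")
  case True
  then show ?thesis using assms by (auto simp: Lp_norm_def intro: esssup_mono)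
next
  case False
  with Lp_norm_finite_exponent(1)[OF assms(1)] assms(3) show ?thesis
    by (auto simp: Lp_norm_def intro!: ennreal_powr_mono nn_integral_mono)
qed

section \<open>Stability of moderate and negligible families under domination\<close>

text \<open>\<open>enn2real\<close> sends top to 0, so a comparison of real values is sound only
  because every term on the right is finite.\<close>

lemma enn2real_le_sum:
  assumes "finite S" "\<And>\<beta>. \<beta> \<in> S \<Longrightarrow> s \<beta> < \<infinity>" "x \<le> ennreal C * (\<Sum>\<beta>\<in>S. s \<beta>)" "0 \<le> C"
  shows "x < \<infinity>" and "enn2real x \<le> C * (\<Sum>\<beta>\<in>S. enn2real (s \<beta>))"
proof -
  have "(\<Sum>\<beta>\<in>S. s \<beta>) = (\<Sum>\<beta>\<in>S. ennreal (enn2real (s \<beta>)))"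
    using assms(2) by (intro sum.cong) auto
  also have "\<dots> = ennreal (\<Sum>\<beta>\<in>S. enn2real (s \<beta>))" by (simp add: sum_ennreal)
  finally have *: "x \<le> ennreal (C * (\<Sum>\<beta>\<in>S. enn2real (s \<beta>)))"
    using assms(3,4) by (simp add: ennreal_mult sum_nonneg)
  then show "x < \<infinity>" using le_less_trans by fastforce
  from * show "enn2real x \<le> C * (\<Sum>\<beta>\<in>S. enn2real (s \<beta>))"
    using assms(4) by (intro enn2real_leI) (auto intro!: mult_nonneg_nonneg sum_nonneg)
qed

lemma family_bigo_sum:
  fixes r :: "real \<Rightarrow> ennreal"
  assumes "finite S" "0 \<le> C"
    and fin: "\<And>\<beta> \<epsilon>. \<beta> \<in> S \<Longrightarrow> \<epsilon> \<in> {0<..1} \<Longrightarrow> s \<beta> \<epsilon> < \<infinity>"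
    and bigo: "\<And>\<beta>. \<beta> \<in> S \<Longrightarrow> (\<lambda>\<epsilon>. enn2real (s \<beta> \<epsilon>)) \<in> O[at_right 0](g)"
    and le: "\<And>\<epsilon>. \<epsilon> \<in> {0<..1} \<Longrightarrow> r \<epsilon> \<le> ennreal C * (\<Sum>\<beta>\<in>S. s \<beta> \<epsilon>)"
  shows "(\<forall>\<epsilon>\<in>{0<..1}. r \<epsilon> < \<infinity>) \<and> (\<lambda>\<epsilon>. enn2real (r \<epsilon>)) \<in> O[at_right 0](g)"
proof
  show "\<forall>\<epsilon>\<in>{0<..1}. r \<epsilon> < \<infinity>"
    using enn2real_le_sum(1)[OF assms(1) fin le assms(2)] by blast
  have "\<forall>\<^sub>F \<epsilon> in at_right 0. \<epsilon> \<in> {0<..1::real}"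
    by (auto simp: eventually_at_right_field intro: exI[of _ 1])
  then have "(\<lambda>\<epsilon>. enn2real (r \<epsilon>)) \<in> O[at_right 0](\<lambda>\<epsilon>. \<Sum>\<beta>\<in>S. enn2real (s \<beta> \<epsilon>))"
    by (intro bigoI[of _ C]) (auto elim!: eventually_mono simp: sum_nonneg
        intro: enn2real_le_sum(2)[OF assms(1) fin le assms(2)])
  also have "(\<lambda>\<epsilon>. \<Sum>\<beta>\<in>S. enn2real (s \<beta> \<epsilon>)) \<in> O[at_right 0](g)"
    by (intro big_sum_in_bigo bigo)
  finally show "(\<lambda>\<epsilon>. enn2real (r \<epsilon>)) \<in> O[at_right 0](g)" .
qed

lemma negligible_family_sum:
  assumes "finite S" "0 \<le> C" "\<And>\<beta>. \<beta> \<in> S \<Longrightarrow> negligible_family (s \<beta>)"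
    and "\<And>\<epsilon>. \<epsilon> \<in> {0<..1} \<Longrightarrow> r \<epsilon> \<le> ennreal C * (\<Sum>\<beta>\<in>S. s \<beta> \<epsilon>)"
  shows "negligible_family r"
proof -
  have "(\<forall>\<epsilon>\<in>{0<..1}. r \<epsilon> < \<infinity>) \<and> (\<lambda>\<epsilon>. enn2real (r \<epsilon>)) \<in> O[at_right 0](\<lambda>\<epsilon>. \<epsilon> powr b)"
    if "b \<ge> 0" for b
    by (rule family_bigo_sum[OF assms(1,2) _ _ assms(4)])
      (use assms(3) that in \<open>auto simp: negligible_family_def\<close>)
  then show ?thesis unfolding negligible_family_def by blast
qed

lemma moderate_family_sum:
  assumes "finite S" "0 \<le> C" "\<And>\<beta>. \<beta> \<in> S \<Longrightarrow> moderate_family (s \<beta>)"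
    and "\<And>\<epsilon>. \<epsilon> \<in> {0<..1} \<Longrightarrow> r \<epsilon> \<le> ennreal C * (\<Sum>\<beta>\<in>S. s \<beta> \<epsilon>)"
  shows "moderate_family r"
proof -
  have "\<forall>\<beta>\<in>S. \<exists>a\<ge>0. (\<lambda>\<epsilon>. enn2real (s \<beta> \<epsilon>)) \<in> O[at_right 0](\<lambda>\<epsilon>. \<epsilon> powr (- a))"
    using assms(3) by (simp add: moderate_family_def)
  then obtain a where a: "\<And>\<beta>. \<beta> \<in> S \<Longrightarrow> a \<beta> \<ge> 0"
    "\<And>\<beta>. \<beta> \<in> S \<Longrightarrow> (\<lambda>\<epsilon>. enn2real (s \<beta> \<epsilon>)) \<in> O[at_right 0](\<lambda>\<epsilon>. \<epsilon> powr (- a \<beta>))"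
    by metis
  \<comment> \<open>A common exponent for the finitely many families: the sum of nonnegative
    exponents exceeds each of them, and \<epsilon> \<le> 1 makes the larger exponent give the weaker
    bound.\<close>
  define A where "A = sum a S"
  have "A \<ge> 0" unfolding A_def using a(1) by (rule sum_nonneg)
  have "(\<lambda>\<epsilon>. enn2real (s \<beta> \<epsilon>)) \<in> O[at_right 0](\<lambda>\<epsilon>. \<epsilon> powr (- A))" if "\<beta> \<in> S" for \<beta>
  proof (rule landau_o.big.trans[OF a(2)[OF that]])
    have "a \<beta> \<le> A" unfolding A_def using assms(1) a(1) that by (intro member_le_sum) auto
    moreover have "\<forall>\<^sub>F \<epsilon> in at_right 0. \<epsilon> \<in> {0<..1::real}"
      by (auto simp: eventually_at_right_field intro: exI[of _ 1])
    ultimately show "(\<lambda>\<epsilon>. \<epsilon> powr (- a \<beta>)) \<in> O[at_right 0](\<lambda>\<epsilon>. \<epsilon> powr (- A))"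
      by (intro bigoI[of _ 1]) (auto elim!: eventually_mono intro: powr_mono')
  qed
  then have "(\<forall>\<epsilon>\<in>{0<..1}. r \<epsilon> < \<infinity>) \<and> (\<lambda>\<epsilon>. enn2real (r \<epsilon>)) \<in> O[at_right 0](\<lambda>\<epsilon>. \<epsilon> powr (- A))"
    by (intro family_bigo_sum[OF assms(1,2) _ _ assms(4)])
      (use assms(3) in \<open>auto simp: moderate_family_def\<close>)
  with \<open>A \<ge> 0\<close> show ?thesis unfolding moderate_family_def by blast
qed

lemma finite_bounded_nat_vec: "finite {\<beta> :: nat^'d::finite. \<forall>k. \<beta> $ k \<le> b k}"
proof (rule finite_subset)
  show "{\<beta>. \<forall>k. \<beta> $ k \<le> b k} \<subseteq> vec_lambda ` (UNIV \<rightarrow>\<^sub>E {.. Max (range b)})"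
  proof
    fix \<beta> :: "nat^'d" assume "\<beta> \<in> {\<beta>. \<forall>k. \<beta> $ k \<le> b k}"
    then have "vec_nth \<beta> \<in> UNIV \<rightarrow>\<^sub>E {.. Max (range b)}"
      by (auto intro: order_trans[OF _ Max_ge])
    then show "\<beta> \<in> vec_lambda ` (UNIV \<rightarrow>\<^sub>E {.. Max (range b)})"
      by (metis image_eqI vec_nth_inverse)
  qed
qed (simp add: finite_PiE)

section \<open>Comparison of the two families of seminorms\<close>

text \<open>The point is the order of quantifiers: C, S and Q are chosen before \<epsilon>, so
  growth in \<epsilon> is inherited.\<close>

lemma norm_sup_family_le:
  fixes u :: "real \<Rightarrow> real^'d::finite \<Rightarrow> 'w \<Rightarrow> real"
  assumes "prob_space M" "complete_measure M" "1 \<le> p"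
    and smooth: "AE \<omega> in M. \<forall>\<epsilon>\<in>{0<..1}. smooth (\<lambda>x. u \<epsilon> x \<omega>)"
    and meas: "\<And>x \<alpha> \<epsilon>. \<epsilon> \<in> {0<..1} \<Longrightarrow> (\<lambda>\<omega>. multi_deriv \<alpha> (\<lambda>y. u \<epsilon> y \<omega>) x) \<in> borel_measurable M"
    and fin: "\<And>K \<alpha> \<epsilon>. compact K \<Longrightarrow> \<epsilon> \<in> {0<..1} \<Longrightarrow> sup_norm_family M p u K \<alpha> \<epsilon> < \<infinity>"
    and "compact K"
  shows "\<exists>C S Q. 0 \<le> C \<and> finite S \<and> compact Q \<and> (\<forall>\<epsilon>\<in>{0<..1}.
    norm_sup_family M p u K \<alpha> \<epsilon> \<le> ennreal C * (\<Sum>\<beta>\<in>S. sup_norm_family M p u Q \<beta> \<epsilon>))"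
proof (cases "p = \<infinity>")
  case True
  have "norm_sup_family M p u K \<alpha> \<epsilon> \<le> ennreal 1 * (\<Sum>\<beta>\<in>{\<alpha>}. sup_norm_family M p u K \<beta> \<epsilon>)"
    if "\<epsilon> \<in> {0<..1}" for \<epsilon>
  proof -
    have "AE \<omega> in M. continuous_on K (multi_deriv \<alpha> (\<lambda>x. u \<epsilon> x \<omega>))"
      using smooth
    proof eventually_elim
      case (elim \<omega>)
      then have "smooth (\<lambda>x. u \<epsilon> x \<omega>)" using that by blast
      then show ?case by (intro smooth_continuous_on smooth_multi_deriv)
    qed
    then have "esssup M (\<lambda>\<omega>. SUP x\<in>K. ennreal \<bar>multi_deriv \<alpha> (\<lambda>y. u \<epsilon> y \<omega>) x\<bar>) \<le> sup_norm_family M p u K \<alpha> \<epsilon>"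
      by (intro esssup_SUP_le[OF assms(2)] meas that)
        (auto simp: sup_norm_family_def Lp_norm_def True intro: SUP_upper)
    then show ?thesis by (simp add: norm_sup_family_def Lp_norm_def True)
  qed
  then show ?thesis using \<open>compact K\<close>
    by (intro exI[of _ 1] exI[of _ "{\<alpha>}"] exI[of _ K]) simp
next
  case False
  obtain R0 where R0: "\<And>x. x \<in> K \<Longrightarrow> norm x \<le> R0"
    using compact_imp_bounded[OF \<open>compact K\<close>] by (auto simp: bounded_iff)
  \<comment> \<open>The maximum with 0 keeps the interval from -R to R nonempty even if K is
    empty.\<close>
  define R where "R = max R0 0"
  have K: "x $ k \<in> {-R..R}" if "x \<in> K" for x k
    using R0[OF that] component_le_norm_cart[of x k] by (auto simp: R_def abs_le_iff)
  define Q where "Q = (cbox (\<chi> k. - R) (\<chi> k. R) :: (real^'d) set)"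
  have Q: "x \<in> Q \<longleftrightarrow> (\<forall>k. x $ k \<in> {-R..R})" for x
    by (simp add: Q_def mem_box_cart)
  have "compact Q" by (simp add: Q_def)
  define S where "S = {\<beta> :: nat^'d. \<forall>k. \<beta> $ k \<le> \<alpha> $ k + CARD('d)}"
  have "finite S" unfolding S_def by (rule finite_bounded_nat_vec)
  define r where "r = enn2real p"
  define C where "C = (((R - (-R) + 2) powr r * (1 + (R - (-R)))) ^ CARD('d)) powr (1 / r)"
  have "norm_sup_family M p u K \<alpha> \<epsilon> \<le> ennreal C * (\<Sum>\<beta>\<in>S. sup_norm_family M p u Q \<beta> \<epsilon>)"
    if \<epsilon>: "\<epsilon> \<in> {0<..1}" for \<epsilon>
  proof -
    \<comment> \<open>A single real bound for all norms that occur: the sum dominates each term, and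
      is finite by \<open>fin\<close>, so \<open>enn2real\<close> loses nothing.\<close>
    define D where "D = enn2real (\<Sum>\<beta>\<in>S. sup_norm_family M p u Q \<beta> \<epsilon>)"
    have D: "ennreal D = (\<Sum>\<beta>\<in>S. sup_norm_family M p u Q \<beta> \<epsilon>)"
      unfolding D_def using fin[OF \<open>compact Q\<close> \<epsilon>] \<open>finite S\<close> by (simp add: less_top[symmetric])
    have "D \<ge> 0" by (simp add: D_def)
    have "norm_sup_family M p u K \<alpha> \<epsilon> \<le> ennreal (C * D)"
      unfolding norm_sup_family_def C_def
    proof (rule Lp_norm_SUP_le_finite_exponent[OF assms(1,3) False])
      show "AE \<omega> in M. smooth (\<lambda>y. u \<epsilon> y \<omega>)" using smooth by eventually_elim (use \<epsilon> in blast)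
      fix \<beta> :: "nat^'d" and x :: "real^'d"
      assume "\<forall>k. \<beta> $ k \<le> \<alpha> $ k + CARD('d)" "\<forall>k. x $ k \<in> {-R..R}"
      then have "\<beta> \<in> S" "x \<in> Q" by (simp_all add: S_def Q)
      have "Lp_norm M p (\<lambda>\<omega>. ennreal \<bar>multi_deriv \<beta> (\<lambda>y. u \<epsilon> y \<omega>) x\<bar>) \<le> sup_norm_family M p u Q \<beta> \<epsilon>"
        unfolding sup_norm_family_def using \<open>x \<in> Q\<close> by (rule SUP_upper)
      also have "\<dots> \<le> ennreal D"
        unfolding D using \<open>finite S\<close> \<open>\<beta> \<in> S\<close> by (intro member_le_sum) auto
      finally show "Lp_norm M p (\<lambda>\<omega>. ennreal \<bar>multi_deriv \<beta> (\<lambda>y. u \<epsilon> y \<omega>) x\<bar>) \<le> ennreal D" .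
    qed (use \<open>D \<ge> 0\<close> K meas[OF \<epsilon>] in \<open>auto simp: R_def r_def\<close>)
    then show ?thesis using \<open>D \<ge> 0\<close> by (simp add: C_def ennreal_mult D)
  qed
  then show ?thesis using \<open>finite S\<close> \<open>compact Q\<close>
    by (intro exI[of _ C] exI[of _ S] exI[of _ Q]) (simp add: C_def)
qed

lemma sup_norm_family_le:
  fixes u :: "real \<Rightarrow> real^'d::finite \<Rightarrow> 'w \<Rightarrow> real"
  assumes "1 \<le> p"
    and "\<And>x. (\<lambda>\<omega>. multi_deriv \<alpha> (\<lambda>y. u \<epsilon> y \<omega>) x) \<in> borel_measurable M"
  shows "sup_norm_family M p u K \<alpha> \<epsilon> \<le> norm_sup_family M p u K \<alpha> \<epsilon>"
  unfolding sup_norm_family_def norm_sup_family_def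
proof (rule SUP_least)
  fix x assume "x \<in> K"
  then show "Lp_norm M p (\<lambda>\<omega>. ennreal \<bar>multi_deriv \<alpha> (\<lambda>y. u \<epsilon> y \<omega>) x\<bar>) \<le>
      Lp_norm M p (\<lambda>\<omega>. SUP x\<in>K. ennreal \<bar>multi_deriv \<alpha> (\<lambda>y. u \<epsilon> y \<omega>) x\<bar>)"
    using assms(2)[of x] by (intro Lp_norm_mono[OF assms(1)]) (auto intro: SUP_upper)
qed

theorem lemma4p1:
  fixes M :: "'w measure"
    and p :: ennreal
    and u :: "real \<Rightarrow> real^'d::finite \<Rightarrow> 'w \<Rightarrow> real"
  assumes "prob_space M" and "complete_measure M"
    and "1 \<le> p"
    and "\<And>\<epsilon>. \<epsilon> \<in> {0<..1} \<Longrightarrow> random_field M (u \<epsilon>)"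
    and "AE \<omega> in M. \<forall>\<epsilon>\<in>{0<..1}. smooth (\<lambda>x. u \<epsilon> x \<omega>)"
    and "\<And>x \<alpha> \<epsilon>. \<epsilon> \<in> {0<..1} \<Longrightarrow> in_Lp M p (\<lambda>\<omega>. multi_deriv \<alpha> (\<lambda>y. u \<epsilon> y \<omega>) x)"
    and "\<And>K \<alpha> \<epsilon>. compact K \<Longrightarrow> \<epsilon> \<in> {0<..1} \<Longrightarrow> sup_norm_family M p u K \<alpha> \<epsilon> < \<infinity>"
  shows "((\<forall>K \<alpha>. compact K \<longrightarrow> moderate_family (sup_norm_family M p u K \<alpha>)) \<longleftrightarrow>
         (\<forall>K \<alpha>. compact K \<longrightarrow> moderate_family (norm_sup_family M p u K \<alpha>))) \<and>
         ((\<forall>K \<alpha>. compact K \<longrightarrow> negligible_family (sup_norm_family M p u K \<alpha>)) \<longleftrightarrow>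
         (\<forall>K \<alpha>. compact K \<longrightarrow> negligible_family (norm_sup_family M p u K \<alpha>)))"
proof -
  have meas: "(\<lambda>\<omega>. multi_deriv \<alpha> (\<lambda>y. u \<epsilon> y \<omega>) x) \<in> borel_measurable M"
    if "\<epsilon> \<in> {0<..1}" for x \<alpha> \<epsilon>
    using assms(6)[OF that] by (simp add: in_Lp_def)
  \<comment> \<open>Both notions enter only through stability under domination by a constant times a
    finite sum, so one argument for a general P settles both equivalences.\<close>
  have transfer: "(\<forall>K \<alpha>. compact K \<longrightarrow> P (sup_norm_family M p u K \<alpha>)) \<longleftrightarrow>
      (\<forall>K \<alpha>. compact K \<longrightarrow> P (norm_sup_family M p u K \<alpha>))"
    if P: "\<And>S C (s :: nat^'d \<Rightarrow> real \<Rightarrow> ennreal) r. finite S \<Longrightarrow> 0 \<le> C \<Longrightarrow>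
        (\<And>\<beta>. \<beta> \<in> S \<Longrightarrow> P (s \<beta>)) \<Longrightarrow>
        (\<And>\<epsilon>. \<epsilon> \<in> {0<..1} \<Longrightarrow> r \<epsilon> \<le> ennreal C * (\<Sum>\<beta>\<in>S. s \<beta> \<epsilon>)) \<Longrightarrow> P r" for P
  proof (intro iffI allI impI)
    fix K :: "(real^'d) set" and \<alpha> :: "nat^'d"
    assume *: "\<forall>K \<alpha>. compact K \<longrightarrow> P (norm_sup_family M p u K \<alpha>)" and K: "compact K"
    show "P (sup_norm_family M p u K \<alpha>)"
      by (rule P[of "{\<alpha>}" 1 "norm_sup_family M p u K"])
        (use * K sup_norm_family_le[OF assms(3) meas] in auto)
  next
    fix K :: "(real^'d) set" and \<alpha> :: "nat^'d"
    assume *: "\<forall>K \<alpha>. compact K \<longrightarrow> P (sup_norm_family M p u K \<alpha>)" and K: "compact K"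
    have "\<exists>C S Q. 0 \<le> C \<and> finite S \<and> compact Q \<and> (\<forall>\<epsilon>\<in>{0<..1}.
        norm_sup_family M p u K \<alpha> \<epsilon> \<le> ennreal C * (\<Sum>\<beta>\<in>S. sup_norm_family M p u Q \<beta> \<epsilon>))"
      by (rule norm_sup_family_le[OF assms(1-3,5) meas assms(7) K])
    then obtain C S Q where CSQ: "0 \<le> C" "finite S" "compact Q"
      "\<And>\<epsilon>. \<epsilon> \<in> {0<..1} \<Longrightarrow>
        norm_sup_family M p u K \<alpha> \<epsilon> \<le> ennreal C * (\<Sum>\<beta>\<in>S. sup_norm_family M p u Q \<beta> \<epsilon>)"
      by blast
    show "P (norm_sup_family M p u K \<alpha>)"
      by (rule P[of S C "sup_norm_family M p u Q"]) (use * CSQ in auto)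
  qed
  show ?thesis
    by (intro conjI transfer) (fact moderate_family_sum negligible_family_sum)+
qed

end
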